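(* Let $\mathsf H$ be a Hilbert space, let $\phi_0$ be a quasicontraction semigroup of linear operators on $\mathsf H$, that is, a strongly continuous semigroup with $$\|\phi_0(h,u)\|_{\mathsf H}\le e^{\kappa_0h}\|u\|_{\mathsf H}\qquad(h\ge 0,\ u\in\mathsf H)$$ for some $\kappa_0\in\mathbb R$, and let $\phi_1$ be a uniformly stable map. Then the method $\Phi$ given either by $\Phi(h)=\sum_{m=1}^s\gamma_m\Phi_m^{\pm}(h/m)$ (one fixed sign) with $\sum_{m=1}^s\gamma_m=1$, or by $\Phi(h)=\sum_{m=1}^s\gamma_m\big(\Phi_m^+(h/m)+\Phi_m^-(h/m)\big)$ with $\sum_{m=1}^s\gamma_m=\frac12$, is a stable map.
   Context: For a continuous map $\varphi:[0,\infty)\times\mathsf H\to\mathsf H$ write $\varphi(h)=\varphi(h,\cdot)$ and suppose each $\varphi(h)$ is Lipschitz continuous and $\varphi(0)=I$. For a map $\varphi$ (also applied to differences such as $\varphi-I$) put $$\Lambda(\varphi,h)=\sup_{u\ne u'\in\mathsf H}\frac{\|\varphi(h,u)-\varphi(h,u')\|_{\mathsf H}}{\|u-u'\|_{\mathsf H}} .$$ $\varphi$ is called stable if $\kappa(\varphi)=\limsup_{h\downarrow0}h^{-1}(\Lambda(\varphi,h)-1)<\infty$, and uniformly stable if $\mu(\varphi)=\limsup_{h\downarrow0}h^{-1}\Lambda(\varphi-I,h)<\infty$. Define $\Phi^+(h)=\phi_1(h)\circ\phi_0(h)$, $\Phi^-(h)=\phi_0(h)\circ\phi_1(h)$, $\Phi_1^\pm=\Phi^\pm$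 and $\Phi_m^\pm(h)=\Phi^\pm(h)\circ\Phi_{m-1}^\pm(h)$ for $m\ge2$. The coefficients $\gamma_1,\dots,\gamma_s$ are real. *)

theory Defs
  imports "HOL-Analysis.Analysis"
begin

text \<open>
  A map \<open>[0,\<infinity>) \<times> H \<rightarrow> H\<close> is a curried function \<open>real \<Rightarrow> 'a \<Rightarrow> 'a\<close> of which only the values
  at times \<open>h \<ge> 0\<close> matter. The space \<open>H\<close> is a type of sort \<open>{real_inner, complete_space}\<close>; a complex
  Hilbert space is covered through its underlying real Hilbert space, which has the same norm.
\<close>

definition lipschitz_map :: "(real \<Rightarrow> 'a::real_normed_vector \<Rightarrow> 'a) \<Rightarrow> bool" where
  "lipschitz_map \<phi> \<longleftrightarrow>
     continuous_on ({0..} \<times> UNIV) (\<lambda>(h, u). \<phi> h u) \<and>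
     (\<forall>h\<ge>0. \<exists>L. L-lipschitz_on UNIV (\<phi> h)) \<and>
     \<phi> 0 = id"

text \<open>
  The supremum is taken in the extended reals. On the zero space the index set is empty and the value
  is \<open>-\<infinity>\<close> rather than \<open>0\<close>; this does not affect whether the upper limits below are \<open>< \<infinity>\<close>.
\<close>

definition Lambda :: "(real \<Rightarrow> 'a::real_normed_vector \<Rightarrow> 'a) \<Rightarrow> real \<Rightarrow> ereal" where
  "Lambda \<phi> h = (SUP (u, u') \<in> {(u, u'). u \<noteq> u'}. ereal (norm (\<phi> h u - \<phi> h u') / norm (u - u')))"

definition kappa :: "(real \<Rightarrow> 'a::real_normed_vector \<Rightarrow> 'a) \<Rightarrow> ereal" where
  "kappa \<phi> = Limsup (at_right 0) (\<lambda>h. (Lambda \<phi> h - 1) / ereal h)"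

definition mu :: "(real \<Rightarrow> 'a::real_normed_vector \<Rightarrow> 'a) \<Rightarrow> ereal" where
  "mu \<phi> = Limsup (at_right 0) (\<lambda>h. Lambda (\<lambda>h u. \<phi> h u - u) h / ereal h)"

definition stable_map :: "(real \<Rightarrow> 'a::real_normed_vector \<Rightarrow> 'a) \<Rightarrow> bool" where
  "stable_map \<phi> \<longleftrightarrow> lipschitz_map \<phi> \<and> kappa \<phi> < \<infinity>"

definition uniformly_stable_map :: "(real \<Rightarrow> 'a::real_normed_vector \<Rightarrow> 'a) \<Rightarrow> bool" where
  "uniformly_stable_map \<phi> \<longleftrightarrow> lipschitz_map \<phi> \<and> mu \<phi> < \<infinity>"

definition strongly_continuous_semigroup :: "(real \<Rightarrow> 'a::real_normed_vector \<Rightarrow> 'a) \<Rightarrow> bool" where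
  "strongly_continuous_semigroup \<phi> \<longleftrightarrow>
     (\<forall>h\<ge>0. bounded_linear (\<phi> h)) \<and>
     \<phi> 0 = id \<and>
     (\<forall>h\<ge>0. \<forall>k\<ge>0. \<phi> (h + k) = \<phi> h \<circ> \<phi> k) \<and>
     (\<forall>u. ((\<lambda>h. \<phi> h u) \<longlongrightarrow> u) (at_right 0))"

definition quasicontraction_semigroup :: "(real \<Rightarrow> 'a::real_normed_vector \<Rightarrow> 'a) \<Rightarrow> bool" where
  "quasicontraction_semigroup \<phi> \<longleftrightarrow>
     strongly_continuous_semigroup \<phi> \<and>
     (\<exists>\<kappa>\<^sub>0::real. \<forall>h\<ge>0. \<forall>u. norm (\<phi> h u) \<le> exp (\<kappa>\<^sub>0 * h) * norm u)"

definition Phi_plus ::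
  "(real \<Rightarrow> 'a \<Rightarrow> 'a) \<Rightarrow> (real \<Rightarrow> 'a \<Rightarrow> 'a) \<Rightarrow> real \<Rightarrow> 'a \<Rightarrow> 'a" where
  "Phi_plus \<phi>\<^sub>0 \<phi>\<^sub>1 h = \<phi>\<^sub>1 h \<circ> \<phi>\<^sub>0 h"

definition Phi_minus ::
  "(real \<Rightarrow> 'a \<Rightarrow> 'a) \<Rightarrow> (real \<Rightarrow> 'a \<Rightarrow> 'a) \<Rightarrow> real \<Rightarrow> 'a \<Rightarrow> 'a" where
  "Phi_minus \<phi>\<^sub>0 \<phi>\<^sub>1 h = \<phi>\<^sub>0 h \<circ> \<phi>\<^sub>1 h"

text \<open>
  In the methods below, the iterate \<open>\<Phi>\<^sub>m(h)\<close>, given by \<open>\<Phi>\<^sub>1 = \<Phi>\<close> and \<open>\<Phi>\<^sub>m(h) = \<Phi>(h) \<circ> \<Phi>\<^sub>m\<^sub>-\<^sub>1(h)\<close>,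
  is the functional power \<open>\<Phi> h ^^ m\<close>.
\<close>

definition asymmetric_method ::
  "nat \<Rightarrow> (nat \<Rightarrow> real) \<Rightarrow> (real \<Rightarrow> 'a::real_vector \<Rightarrow> 'a) \<Rightarrow> real \<Rightarrow> 'a \<Rightarrow> 'a" where
  "asymmetric_method s \<gamma> \<Phi> h u = (\<Sum>m=1..s. \<gamma> m *\<^sub>R (\<Phi> (h / real m) ^^ m) u)"

definition symmetric_method ::
  "nat \<Rightarrow> (nat \<Rightarrow> real) \<Rightarrow> (real \<Rightarrow> 'a::real_vector \<Rightarrow> 'a) \<Rightarrow> (real \<Rightarrow> 'a \<Rightarrow> 'a) \<Rightarrow>
     real \<Rightarrow> 'a \<Rightarrow> 'a" where
  "symmetric_method s \<gamma> \<Phi> \<Psi> h u =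
     (\<Sum>m=1..s. \<gamma> m *\<^sub>R ((\<Phi> (h / real m) ^^ m) u + (\<Psi> (h / real m) ^^ m) u))"

end

theory Submission
  imports Defs
begin

text \<open>
  Uniform stability of \<open>\<phi>\<^sub>1\<close> says that \<open>\<phi>\<^sub>1(h) - I\<close> has Lipschitz constant \<open>O(h)\<close>. By linearity of
  \<open>\<phi>\<^sub>0\<close> and the semigroup property, \<open>\<Phi>\<^sub>m\<^sup>\<plusminus>(h/m) - \<phi>\<^sub>0(h)\<close> then has Lipschitz constant \<open>O(h)\<close> too. Since
  the coefficients of the method add up to \<open>1\<close>, the method differs from \<open>\<phi>\<^sub>0(h)\<close> by a map with
  Lipschitz constant \<open>O(h)\<close>, whatever the signs of the coefficients; and \<open>\<phi>\<^sub>0(h)\<close> itself has Lipschitz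
  constant \<open>e\<^bsup>\<kappa>\<^sub>0h\<^esup> \<le> 1 + O(h)\<close>.
\<close>

subsection \<open>Lipschitz maps\<close>

lemma lipschitz_map_continuous_on:
  assumes "lipschitz_map \<phi>"
  shows "continuous_on ({0..} \<times> UNIV) (\<lambda>x. \<phi> (fst x) (snd x))"
  using assms by (simp add: lipschitz_map_def case_prod_unfold)

lemma lipschitz_map_id: "lipschitz_map (\<lambda>h::real. id :: 'a::real_normed_vector \<Rightarrow> 'a)"
proof -
  have "\<exists>L. L-lipschitz_on UNIV (id :: 'a \<Rightarrow> 'a)"
    using lipschitz_on_id[of UNIV] by (auto simp: id_def)
  then show ?thesis
    unfolding lipschitz_map_def
    by (simp add: case_prod_unfold continuous_on_snd continuous_on_id)
qed

lemma lipschitz_map_comp: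
  assumes "lipschitz_map \<phi>" "lipschitz_map \<psi>"
  shows "lipschitz_map (\<lambda>h. \<phi> h \<circ> \<psi> h)"
proof -
  have "continuous_on ({0..} \<times> UNIV) (\<lambda>x. (fst x, \<psi> (fst x) (snd x)))"
    by (intro continuous_on_Pair continuous_on_fst continuous_on_id
        lipschitz_map_continuous_on[OF assms(2)])
  then have "continuous_on ({0..} \<times> UNIV) (\<lambda>x. \<phi> (fst x) (\<psi> (fst x) (snd x)))"
    using continuous_on_compose2[OF lipschitz_map_continuous_on[OF assms(1)]] by fastforce
  moreover have "\<exists>L. L-lipschitz_on UNIV (\<phi> h \<circ> \<psi> h)" if "h \<ge> 0" for h
  proof -
    obtain L M where "L-lipschitz_on UNIV (\<phi> h)" "M-lipschitz_on UNIV (\<psi> h)"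
      using assms \<open>h \<ge> 0\<close> unfolding lipschitz_map_def by blast
    then have "(L * M)-lipschitz_on UNIV (\<phi> h \<circ> \<psi> h)"
      by (intro lipschitz_on_compose) (auto intro: lipschitz_on_subset)
    then show ?thesis ..
  qed
  moreover have "\<phi> 0 \<circ> \<psi> 0 = id"
    using assms by (simp add: lipschitz_map_def)
  ultimately show ?thesis
    by (simp add: lipschitz_map_def case_prod_unfold)
qed

lemma lipschitz_map_funpow:
  assumes "lipschitz_map \<phi>"
  shows "lipschitz_map (\<lambda>h. \<phi> h ^^ m)"
proof (induction m)
  case 0
  then show ?case
    using lipschitz_map_id by (simp add: id_def)
next
  case (Suc m)
  then show ?case
    using lipschitz_map_comp[OF assms Suc] by (simp add: comp_def)
qed

lemma lipschitz_map_rescale: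
  fixes \<phi> :: "real \<Rightarrow> 'a::real_normed_vector \<Rightarrow> 'a"
  assumes "lipschitz_map \<phi>" "c \<ge> 0"
  shows "lipschitz_map (\<lambda>h. \<phi> (h / c))"
proof -
  \<comment> \<open>Multiplication by \<open>inverse c\<close> is continuous without a case split on
    \<open>c = 0\<close>. There \<open>inverse 0 = 0\<close>, and the rescaled map is the identity
    at all times.\<close>
  have "continuous_on ({0..} \<times> UNIV) (\<lambda>x::real \<times> 'a. (fst x * inverse c, snd x))"
    by (intro continuous_intros)
  moreover have "(\<lambda>x. (fst x * inverse c, snd x)) ` ({0..} \<times> UNIV) \<subseteq> {0..} \<times> (UNIV :: 'a set)"
    using assms(2) by auto
  ultimately have "continuous_on ({0..} \<times> UNIV) (\<lambda>x. \<phi> (fst x / c) (snd x))"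
    using continuous_on_compose2[OF lipschitz_map_continuous_on[OF assms(1)]]
    by (fastforce simp: divide_inverse)
  then show ?thesis
    using assms unfolding lipschitz_map_def by (auto simp: case_prod_unfold)
qed

lemma lipschitz_on_sum:
  fixes f :: "'i \<Rightarrow> 'a::metric_space \<Rightarrow> 'b::real_normed_vector"
  assumes "\<And>i. i \<in> I \<Longrightarrow> (L i)-lipschitz_on U (f i)"
  shows "(\<Sum>i\<in>I. L i)-lipschitz_on U (\<lambda>u. \<Sum>i\<in>I. f i u)"
  using assms
proof (induction I rule: infinite_finite_induct)
  case (insert i I)
  then show ?case
    by (auto intro!: lipschitz_on_add)
qed (auto intro: lipschitz_on_constant)

text \<open>The condition on the weights serves time \<open>0\<close>, where every
  \<open>f i\<close> is the identity and the combination has to be the identity again. Weights of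
  either sign enter the Lipschitz constant through their absolute values.\<close>

lemma lipschitz_map_affine_combination:
  assumes "\<And>i. i \<in> I \<Longrightarrow> lipschitz_map (f i)" "(\<Sum>i\<in>I. c i) = 1"
  shows "lipschitz_map (\<lambda>h u. \<Sum>i\<in>I. c i *\<^sub>R f i h u)"
proof -
  have "continuous_on ({0..} \<times> UNIV) (\<lambda>x. \<Sum>i\<in>I. c i *\<^sub>R f i (fst x) (snd x))"
    using assms(1) by (intro continuous_on_sum continuous_on_scaleR continuous_on_const
        lipschitz_map_continuous_on)
  moreover have "\<exists>L. L-lipschitz_on UNIV (\<lambda>u. \<Sum>i\<in>I. c i *\<^sub>R f i h u)" if "h \<ge> 0" for h
  proof -
    have "\<forall>i\<in>I. \<exists>L. L-lipschitz_on UNIV (f i h)"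
      using assms(1) that unfolding lipschitz_map_def by blast
    then obtain L where "\<And>i. i \<in> I \<Longrightarrow> (L i)-lipschitz_on UNIV (f i h)"
      by metis
    then have "(\<Sum>i\<in>I. \<bar>c i\<bar> * L i)-lipschitz_on UNIV (\<lambda>u. \<Sum>i\<in>I. c i *\<^sub>R f i h u)"
      by (intro lipschitz_on_sum lipschitz_on_cmult) auto
    then show ?thesis ..
  qed
  moreover have "(\<Sum>i\<in>I. c i *\<^sub>R f i 0 u) = u" for u
  proof -
    have "(\<Sum>i\<in>I. c i *\<^sub>R f i 0 u) = (\<Sum>i\<in>I. c i *\<^sub>R u)"
      using assms(1) by (intro sum.cong) (auto simp: lipschitz_map_def)
    then show ?thesis
      using assms(2) by (simp flip: scaleR_sum_left)
  qed
  ultimately show ?thesis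
    unfolding lipschitz_map_def by (auto simp: case_prod_unfold)
qed

subsection \<open>Quasicontraction semigroups\<close>

text \<open>Raising a negative exponent to \<open>0\<close> makes \<open>exp (K * h)\<close>
  nondecreasing in \<open>h\<close>, so that it is at most \<open>exp K\<close> for \<open>h\<close>
  in the unit interval. The later estimates rely on this.\<close>

lemma quasicontraction_semigroupE:
  assumes "quasicontraction_semigroup \<phi>"
  obtains K where "K \<ge> 0" "\<And>h u. h \<ge> 0 \<Longrightarrow> norm (\<phi> h u) \<le> exp (K * h) * norm u"
proof -
  obtain k where k: "\<And>h u. h \<ge> 0 \<Longrightarrow> norm (\<phi> h u) \<le> exp (k * h) * norm u"
    using assms unfolding quasicontraction_semigroup_def by blast
  have "norm (\<phi> h u) \<le> exp (max k 0 * h) * norm u" if "h \<ge> 0" for h u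
    by (rule order_trans[OF k[OF that]]) (use that in \<open>auto intro!: mult_right_mono\<close>)
  then show thesis
    by (intro that[of "max k 0"]) auto
qed

lemma quasicontraction_semigroup_bounded_linear:
  assumes "quasicontraction_semigroup \<phi>" "h \<ge> 0"
  shows "bounded_linear (\<phi> h)"
  using assms unfolding quasicontraction_semigroup_def strongly_continuous_semigroup_def by blast

lemma quasicontraction_semigroup_add:
  assumes "quasicontraction_semigroup \<phi>" "h \<ge> 0" "k \<ge> 0"
  shows "\<phi> (h + k) = \<phi> h \<circ> \<phi> k"
  using assms unfolding quasicontraction_semigroup_def strongly_continuous_semigroup_def by blast

text \<open>Strong continuity at \<open>0\<close> from the right becomes joint continuity by the
  splitting \<open>\<phi> h u - \<phi> k v = \<phi> h (u - v) + (\<phi> h v - \<phi> k v)\<close>.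
  The growth bound controls the first term, and the semigroup law moves the second one to time
  \<open>0\<close>.\<close>

lemma quasicontraction_semigroup_continuous_on:
  assumes "quasicontraction_semigroup \<phi>"
  shows "continuous_on ({0..} \<times> UNIV) (\<lambda>(h, u). \<phi> h u)"
proof -
  obtain K where K: "K \<ge> 0" "\<And>h u. h \<ge> 0 \<Longrightarrow> norm (\<phi> h u) \<le> exp (K * h) * norm u"
    using quasicontraction_semigroupE[OF assms] by blast
  have zero: "\<phi> 0 = id" and cont: "\<And>u. ((\<lambda>h. \<phi> h u) \<longlongrightarrow> u) (at_right 0)"
    using assms unfolding quasicontraction_semigroup_def strongly_continuous_semigroup_def by blast+
  have diff: "\<phi> h (u - v) = \<phi> h u - \<phi> h v" if "h \<ge> 0" for h u v
    using quasicontraction_semigroup_bounded_linear[OF assms that]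
    by (rule bounded_linear.linear[THEN linear_diff])
  \<comment> \<open>Factoring out the semigroup at the smaller of the two times leaves an increment
    that starts at time \<open>0\<close>. Continuity from the left and from the right thus both
    reduce to continuity from the right at \<open>0\<close>.\<close>
  have increment: "norm (\<phi> h u - \<phi> k u) \<le> exp (K * max h k) * norm (\<phi> \<bar>h - k\<bar> u - u)"
    if "h \<ge> 0" "k \<ge> 0" for h k u
    using that
  proof (induction h k rule: linorder_wlog)
    case (le h k)
    have "\<phi> k u = \<phi> h (\<phi> (k - h) u)"
      using quasicontraction_semigroup_add[OF assms, of h "k - h"] le by simp
    then have "norm (\<phi> h u - \<phi> k u) = norm (\<phi> h (\<phi> (k - h) u - u))"
      using diff le by (simp add: norm_minus_commute)
    also have "\<dots> \<le> exp (K * h) * norm (\<phi> (k - h) u - u)"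
      using K le by blast
    also have "\<dots> \<le> exp (K * max h k) * norm (\<phi> \<bar>h - k\<bar> u - u)"
      using le K by (auto simp: abs_minus_commute intro!: mult_right_mono mult_left_mono)
    finally show ?case .
  next
    case (sym h k)
    then show ?case
      by (simp add: norm_minus_commute abs_minus_commute max.commute)
  qed
  have right: "((\<lambda>h. \<phi> h u) \<longlongrightarrow> u) (at 0 within {0..})" for u
    using cont[of u] zero by (simp add: at_within_Ici_at_right)
  have "((\<lambda>(h, u). \<phi> h u) \<longlongrightarrow> \<phi> k v) (at (k, v) within {0..} \<times> UNIV)" (is "(_ \<longlongrightarrow> _) ?F")
    if "k \<ge> 0" for k v
  proof -
    have h: "(fst \<longlongrightarrow> k) ?F" and u: "(snd \<longlongrightarrow> v) ?F"
      by (auto intro!: tendsto_eq_intros)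
    have "((\<lambda>x. \<bar>fst x - k\<bar>) \<longlongrightarrow> 0) ?F"
      using h by (auto intro!: tendsto_eq_intros)
    \<comment> \<open>Along \<open>?F\<close> the time difference may equal \<open>0\<close>, when
      only the second component varies. Hence the composition needs continuity at \<open>0\<close>,
      with the value \<open>\<phi> 0 v = v\<close>, and not merely the limit.\<close>
    then have "((\<lambda>x. \<phi> \<bar>fst x - k\<bar> v) \<longlongrightarrow> v) ?F"
      using continuous_within_tendsto_compose'[of 0 "{0..}" "\<lambda>h. \<phi> h v" "\<lambda>x. \<bar>fst x - k\<bar>"]
        right[of v] zero
      by (simp add: continuous_within)
    then have lim: "((\<lambda>x. exp (K * fst x) * norm (snd x - v) +
          exp (K * max (fst x) k) * norm (\<phi> \<bar>fst x - k\<bar> v - v)) \<longlongrightarrow> 0) ?F"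
      using h u by (auto intro!: tendsto_eq_intros)
    have "norm (\<phi> h u - \<phi> k v) \<le>
        exp (K * h) * norm (u - v) + exp (K * max h k) * norm (\<phi> \<bar>h - k\<bar> v - v)"
      if "h \<ge> 0" for h u
    proof -
      have "\<phi> h (u - v) + (\<phi> h v - \<phi> k v) = \<phi> h u - \<phi> k v"
        using diff that by simp
      then show ?thesis
        using norm_triangle_mono[OF K(2)[OF that, of "u - v"] increment[OF that \<open>k \<ge> 0\<close>, of v]]
        by (simp only:)
    qed
    then have "eventually (\<lambda>x. norm ((\<lambda>(h, u). \<phi> h u) x - \<phi> k v) \<le> exp (K * fst x) * norm (snd x - v) +
          exp (K * max (fst x) k) * norm (\<phi> \<bar>fst x - k\<bar> v - v)) ?F"
      unfolding eventually_at_filter by (intro always_eventually) auto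
    then show ?thesis
      by (rule Lim_null[THEN iffD2, OF Lim_null_comparison[OF _ lim]])
  qed
  then show ?thesis
    by (auto simp: continuous_on_def)
qed

lemma quasicontraction_semigroup_lipschitz_map:
  assumes "quasicontraction_semigroup \<phi>"
  shows "lipschitz_map \<phi>"
proof -
  have "\<exists>L. L-lipschitz_on UNIV (\<phi> h)" if "h \<ge> 0" for h
    using bounded_linear.lipschitz_boundE[OF quasicontraction_semigroup_bounded_linear[OF assms that]]
    by blast
  then show ?thesis
    using assms quasicontraction_semigroup_continuous_on[OF assms]
    unfolding lipschitz_map_def quasicontraction_semigroup_def strongly_continuous_semigroup_def
    by blast
qed

lemma quasicontraction_semigroup_lipschitz_on:
  assumes "quasicontraction_semigroup \<phi>"
  obtains K where "K \<ge> 0" "\<And>h. h \<ge> 0 \<Longrightarrow> (exp (K * h))-lipschitz_on UNIV (\<phi> h)"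
proof -
  obtain K where K: "K \<ge> 0" "\<And>h u. h \<ge> 0 \<Longrightarrow> norm (\<phi> h u) \<le> exp (K * h) * norm u"
    using quasicontraction_semigroupE[OF assms] by blast
  have "(exp (K * h))-lipschitz_on UNIV (\<phi> h)" if "h \<ge> 0" for h
  proof (rule lipschitz_onI)
    fix u v
    show "dist (\<phi> h u) (\<phi> h v) \<le> exp (K * h) * dist u v"
      using K(2)[OF that, of "u - v"]
        bounded_linear.linear[OF quasicontraction_semigroup_bounded_linear[OF assms that]]
      by (simp add: dist_norm linear_diff)
  qed simp
  then show thesis
    using K that by blast
qed

subsection \<open>Lipschitz closeness\<close>

text \<open>A working substitute for the extended-real upper limits: a bound of order
  \<open>h\<close> with a real constant, which can be carried through compositions, sums and
  rescaling of time. Lipschitz constants are nonnegative by definition, so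
  \<open>0 \<le> B * h\<close> is implied for small \<open>h > 0\<close>.\<close>

definition lipschitz_close ::
  "(real \<Rightarrow> 'a::real_normed_vector \<Rightarrow> 'a) \<Rightarrow> (real \<Rightarrow> 'a \<Rightarrow> 'a) \<Rightarrow> bool" where
  "lipschitz_close \<phi> \<psi> \<longleftrightarrow>
     (\<exists>B. eventually (\<lambda>h. (B * h)-lipschitz_on UNIV (\<lambda>u. \<phi> h u - \<psi> h u)) (at_right 0))"

lemma uniformly_stable_map_lipschitz_close:
  assumes "uniformly_stable_map \<phi>"
  shows "lipschitz_close \<phi> (\<lambda>h u. u)"
proof -
  have "mu \<phi> < \<infinity>"
    using assms unfolding uniformly_stable_map_def by blast
  then obtain C where C: "mu \<phi> < ereal C"
    using ereal_dense2 by blast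
  have "eventually (\<lambda>h. Lambda (\<lambda>h u. \<phi> h u - u) h / ereal h < ereal C) (at_right 0)"
    using C unfolding mu_def by (rule Limsup_lessD)
  \<comment> \<open>On the zero space \<open>mu \<phi>\<close> is minus infinity and
    \<open>C\<close> may be negative, which a Lipschitz constant may not be; hence
    \<open>max C 0\<close>.\<close>
  then have "eventually (\<lambda>h. (max C 0 * h)-lipschitz_on UNIV (\<lambda>u. \<phi> h u - u)) (at_right 0)"
    using eventually_at_right_less[of 0]
  proof eventually_elim
    case (elim h)
    then have L: "Lambda (\<lambda>h u. \<phi> h u - u) h < ereal (C * h)"
      by (subst (asm) ereal_divide_less_iff) (auto simp: mult.commute)
    show ?case
    proof (rule lipschitz_onI)
      fix u v
      show "dist (\<phi> h u - u) (\<phi> h v - v) \<le> max C 0 * h * dist u v"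
      proof (cases "u = v")
        case False
        have "ereal (norm ((\<phi> h u - u) - (\<phi> h v - v)) / norm (u - v)) \<le> Lambda (\<lambda>h u. \<phi> h u - u) h"
          unfolding Lambda_def using False by (intro SUP_upper2[of "(u, v)"]) auto
        then have "norm ((\<phi> h u - u) - (\<phi> h v - v)) / norm (u - v) \<le> C * h"
          using le_less_trans[OF _ L] by fastforce
        also have "\<dots> \<le> max C 0 * h"
          using elim by (intro mult_right_mono) auto
        finally show ?thesis
          using False by (simp add: dist_norm divide_le_eq)
      qed simp
    qed (use elim in simp)
  qed
  then show ?thesis
    unfolding lipschitz_close_def by blast
qed

text \<open>Writing \<open>\<phi>\<close> as
  \<open>(\<phi> - \<phi>\<^sub>0) + \<phi>\<^sub>0\<close> gives the Lipschitz constant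
  \<open>B * h + exp (K * h)\<close>, which is \<open>1\<close> plus a term of order
  \<open>h\<close>.\<close>

lemma lipschitz_close_stable_map:
  assumes "lipschitz_map \<phi>" "quasicontraction_semigroup \<phi>\<^sub>0" "lipschitz_close \<phi> \<phi>\<^sub>0"
  shows "stable_map \<phi>"
proof -
  obtain K where K: "K \<ge> 0" "\<And>h. h \<ge> 0 \<Longrightarrow> (exp (K * h))-lipschitz_on UNIV (\<phi>\<^sub>0 h)"
    using quasicontraction_semigroup_lipschitz_on[OF assms(2)] by blast
  obtain B where "eventually (\<lambda>h. (B * h)-lipschitz_on UNIV (\<lambda>u. \<phi> h u - \<phi>\<^sub>0 h u)) (at_right 0)"
    using assms(3) unfolding lipschitz_close_def by blast
  \<comment> \<open>The summand \<open>K * exp K\<close> bounds \<open>(exp (K * h) - 1) / h\<close>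
    for \<open>0 < h < 1\<close>.\<close>
  then have "eventually (\<lambda>h. (Lambda \<phi> h - 1) / ereal h \<le> ereal (B + K * exp K)) (at_right 0)"
    using eventually_at_right_real[of 0 1, OF zero_less_one]
  proof eventually_elim
    case (elim h)
    then have h: "0 < h" "h < 1"
      by auto
    have "(B * h + exp (K * h))-lipschitz_on UNIV (\<lambda>u. (\<phi> h u - \<phi>\<^sub>0 h u) + \<phi>\<^sub>0 h u)"
      using elim h K by (intro lipschitz_on_add) auto
    then have lip: "(B * h + exp (K * h))-lipschitz_on UNIV (\<phi> h)"
      by simp
    \<comment> \<open>\<open>e\<^sup>x - 1 \<le> x e\<^sup>x\<close>, from \<open>1 - x \<le> e\<^sup>-\<^sup>x\<close>\<close>
    have "exp (K * h) * (1 - K * h) \<le> exp (K * h) * exp (- (K * h))"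
      using exp_ge_add_one_self[of "- (K * h)"] by (intro mult_left_mono) auto
    then have "exp (K * h) \<le> 1 + K * h * exp (K * h)"
      by (simp add: exp_minus_inverse algebra_simps)
    also have "\<dots> \<le> 1 + K * h * exp K"
      using h K by (auto intro!: mult_left_mono mult_left_le)
    finally have const: "B * h + exp (K * h) \<le> 1 + (B + K * exp K) * h"
      by (simp add: algebra_simps)
    have "Lambda \<phi> h \<le> ereal (1 + (B + K * exp K) * h)"
      unfolding Lambda_def
    proof (intro SUP_least, clarify)
      fix u v :: 'a
      assume "u \<noteq> v"
      have "norm (\<phi> h u - \<phi> h v) / norm (u - v) \<le> B * h + exp (K * h)"
        using lipschitz_onD[OF lip, of u v] \<open>u \<noteq> v\<close> by (simp add: dist_norm divide_le_eq)
      then show "ereal (norm (\<phi> h u - \<phi> h v) / norm (u - v)) \<le> ereal (1 + (B + K * exp K) * h)"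
        using const by simp
    qed
    then have "Lambda \<phi> h - 1 \<le> ereal ((B + K * exp K) * h)"
      \<comment> \<open>The case of minus infinity, which is the value on the zero space, is
        included.\<close>
      by (cases "Lambda \<phi> h") (auto simp: one_ereal_def)
    then show ?case
      using h by (subst ereal_divide_le_pos) (auto simp: mult.commute)
  qed
  then have "kappa \<phi> \<le> ereal (B + K * exp K)"
    unfolding kappa_def by (rule Limsup_bounded)
  then show ?thesis
    using assms(1) unfolding stable_map_def by (auto simp: le_less_trans)
qed

lemma lipschitz_close_rescale:
  assumes "lipschitz_close \<phi> \<psi>" "c > 0"
  shows "lipschitz_close (\<lambda>h. \<phi> (h / c)) (\<lambda>h. \<psi> (h / c))"
proof -
  obtain B where B: "eventually (\<lambda>h. (B * h)-lipschitz_on UNIV (\<lambda>u. \<phi> h u - \<psi> h u)) (at_right 0)"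
    using assms(1) unfolding lipschitz_close_def by blast
  have "filterlim (\<lambda>h. h / c) (at_right 0) (at_right 0)"
    using assms(2) unfolding filterlim_at
    by (auto simp: eventually_at_filter intro!: tendsto_eq_intros)
  then have "eventually (\<lambda>h. (B / c * h)-lipschitz_on UNIV (\<lambda>u. \<phi> (h / c) u - \<psi> (h / c) u)) (at_right 0)"
    using B by (auto dest: eventually_compose_filterlim)
  then show ?thesis
    unfolding lipschitz_close_def by blast
qed

text \<open>Because the weights add up to \<open>1\<close>, \<open>\<psi>\<close> is the same
  combination of copies of itself and can be subtracted term by term.\<close>

lemma lipschitz_close_affine_combination:
  assumes "\<And>i. i \<in> I \<Longrightarrow> lipschitz_close (f i) \<psi>" "(\<Sum>i\<in>I. c i) = 1"
  shows "lipschitz_close (\<lambda>h u. \<Sum>i\<in>I. c i *\<^sub>R f i h u) \<psi>"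
proof -
  \<comment> \<open>A sum over an infinite set is \<open>0\<close> by convention, so the value
    \<open>1\<close> forces finiteness. It allows finitely many eventual bounds to be merged into
    one.\<close>
  have "finite I"
    using assms(2) sum.infinite by fastforce
  have "\<forall>i\<in>I. \<exists>B. eventually (\<lambda>h. (B * h)-lipschitz_on UNIV (\<lambda>u. f i h u - \<psi> h u)) (at_right 0)"
    using assms(1) unfolding lipschitz_close_def by blast
  then obtain B where
    "\<forall>i\<in>I. eventually (\<lambda>h. (B i * h)-lipschitz_on UNIV (\<lambda>u. f i h u - \<psi> h u)) (at_right 0)"
    by metis
  then have "eventually (\<lambda>h. \<forall>i\<in>I. (B i * h)-lipschitz_on UNIV (\<lambda>u. f i h u - \<psi> h u)) (at_right 0)"
    using \<open>finite I\<close> by (simp add: eventually_ball_finite)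
  then have "eventually (\<lambda>h. ((\<Sum>i\<in>I. \<bar>c i\<bar> * B i) * h)-lipschitz_on UNIV
      (\<lambda>u. (\<Sum>i\<in>I. c i *\<^sub>R f i h u) - \<psi> h u)) (at_right 0)"
  proof eventually_elim
    case (elim h)
    then have "(\<Sum>i\<in>I. \<bar>c i\<bar> * (B i * h))-lipschitz_on UNIV (\<lambda>u. \<Sum>i\<in>I. c i *\<^sub>R (f i h u - \<psi> h u))"
      by (intro lipschitz_on_sum lipschitz_on_cmult) auto
    moreover have "(\<Sum>i\<in>I. c i *\<^sub>R (f i h u - \<psi> h u)) = (\<Sum>i\<in>I. c i *\<^sub>R f i h u) - \<psi> h u" for u
      using assms(2) by (simp add: scaleR_diff_right sum_subtractf flip: scaleR_sum_left)
    ultimately show ?case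
      by (simp add: sum_distrib_right mult.assoc)
  qed
  then show ?thesis
    unfolding lipschitz_close_def by blast
qed

text \<open>The difference is \<open>(\<phi>\<^sub>1 h - I) \<circ> \<phi>\<^sub>0 h\<close>, so the
  Lipschitz constants \<open>B * h\<close> and \<open>exp (K * h)\<close> multiply.\<close>

lemma lipschitz_close_Phi_plus:
  assumes "quasicontraction_semigroup \<phi>\<^sub>0" "lipschitz_close \<phi>\<^sub>1 (\<lambda>h u. u)"
  shows "lipschitz_close (Phi_plus \<phi>\<^sub>0 \<phi>\<^sub>1) \<phi>\<^sub>0"
proof -
  obtain K where K: "K \<ge> 0" "\<And>h. h \<ge> 0 \<Longrightarrow> (exp (K * h))-lipschitz_on UNIV (\<phi>\<^sub>0 h)"
    using quasicontraction_semigroup_lipschitz_on[OF assms(1)] by blast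
  obtain B where "eventually (\<lambda>h. (B * h)-lipschitz_on UNIV (\<lambda>u. \<phi>\<^sub>1 h u - u)) (at_right 0)"
    using assms(2) unfolding lipschitz_close_def by blast
  then have "eventually (\<lambda>h. (B * exp K * h)-lipschitz_on UNIV
      (\<lambda>u. Phi_plus \<phi>\<^sub>0 \<phi>\<^sub>1 h u - \<phi>\<^sub>0 h u)) (at_right 0)"
    using eventually_at_right_real[of 0 1, OF zero_less_one]
  proof eventually_elim
    case (elim h)
    then have "0 \<le> B * h"
      using lipschitz_on_nonneg by blast
    have "(exp (K * h))-lipschitz_on UNIV (\<phi>\<^sub>0 h)"
      using K elim by auto
    then have "(B * h * exp (K * h))-lipschitz_on UNIV (\<lambda>u. \<phi>\<^sub>1 h (\<phi>\<^sub>0 h u) - \<phi>\<^sub>0 h u)"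
      by (rule lipschitz_on_compose2) (use elim in \<open>auto intro: lipschitz_on_subset\<close>)
    then have "(B * h * exp K)-lipschitz_on UNIV (\<lambda>u. \<phi>\<^sub>1 h (\<phi>\<^sub>0 h u) - \<phi>\<^sub>0 h u)"
      by (rule lipschitz_on_mono)
         (use \<open>0 \<le> B * h\<close> K elim in \<open>auto intro!: mult_left_mono mult_left_le\<close>)
    then show ?case
      by (simp add: Phi_plus_def mult_ac)
  qed
  then show ?thesis
    unfolding lipschitz_close_def by blast
qed

text \<open>Linearity of \<open>\<phi>\<^sub>0 h\<close> turns the difference into
  \<open>\<phi>\<^sub>0 h \<circ> (\<phi>\<^sub>1 h - I)\<close>; for a nonlinear outer map, a
  Lipschitz bound alone would not make the difference Lipschitz of order \<open>h\<close>.\<close>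

lemma lipschitz_close_Phi_minus:
  assumes "quasicontraction_semigroup \<phi>\<^sub>0" "lipschitz_close \<phi>\<^sub>1 (\<lambda>h u. u)"
  shows "lipschitz_close (Phi_minus \<phi>\<^sub>0 \<phi>\<^sub>1) \<phi>\<^sub>0"
proof -
  obtain K where K: "K \<ge> 0" "\<And>h. h \<ge> 0 \<Longrightarrow> (exp (K * h))-lipschitz_on UNIV (\<phi>\<^sub>0 h)"
    using quasicontraction_semigroup_lipschitz_on[OF assms(1)] by blast
  obtain B where "eventually (\<lambda>h. (B * h)-lipschitz_on UNIV (\<lambda>u. \<phi>\<^sub>1 h u - u)) (at_right 0)"
    using assms(2) unfolding lipschitz_close_def by blast
  then have "eventually (\<lambda>h. (B * exp K * h)-lipschitz_on UNIV
      (\<lambda>u. Phi_minus \<phi>\<^sub>0 \<phi>\<^sub>1 h u - \<phi>\<^sub>0 h u)) (at_right 0)"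
    using eventually_at_right_real[of 0 1, OF zero_less_one]
  proof eventually_elim
    case (elim h)
    then have "0 \<le> B * h"
      using lipschitz_on_nonneg by blast
    have "(exp (K * h))-lipschitz_on UNIV (\<phi>\<^sub>0 h)"
      using K elim by auto
    then have "(exp (K * h) * (B * h))-lipschitz_on UNIV (\<lambda>u. \<phi>\<^sub>0 h (\<phi>\<^sub>1 h u - u))"
      using lipschitz_on_compose2[OF elim(1)] lipschitz_on_subset by blast
    then have "(exp K * (B * h))-lipschitz_on UNIV (\<lambda>u. \<phi>\<^sub>0 h (\<phi>\<^sub>1 h u - u))"
      by (rule lipschitz_on_mono)
         (use \<open>0 \<le> B * h\<close> K elim in \<open>auto intro!: mult_right_mono mult_left_le\<close>)
    then show ?case
      using elim bounded_linear.linear[OF quasicontraction_semigroup_bounded_linear[OF assms(1), of h]]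
      by (simp add: Phi_minus_def linear_diff mult_ac)
  qed
  then show ?thesis
    unfolding lipschitz_close_def by blast
qed

text \<open>
  The step rests on \<open>\<Phi>\<^sup>m\<^sup>+\<^sup>1(h) - \<phi>\<^sub>0((m+1)h) = (\<Phi>(h) - \<phi>\<^sub>0(h)) \<circ> \<Phi>\<^sup>m(h) + \<phi>\<^sub>0(h) \<circ> (\<Phi>\<^sup>m(h) - \<phi>\<^sub>0(mh))\<close>.
\<close>

lemma lipschitz_close_funpow:
  assumes "quasicontraction_semigroup \<phi>\<^sub>0" "lipschitz_close \<Phi> \<phi>\<^sub>0"
  shows "lipschitz_close (\<lambda>h. \<Phi> h ^^ m) (\<lambda>h. \<phi>\<^sub>0 (real m * h))"
proof (induction m)
  case 0
  have "\<phi>\<^sub>0 0 = id"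
    using quasicontraction_semigroup_lipschitz_map[OF assms(1)] by (simp add: lipschitz_map_def)
  then show ?case
    unfolding lipschitz_close_def by (intro exI[of _ 0]) (simp add: lipschitz_on_constant)
next
  case (Suc m)
  obtain K where K: "K \<ge> 0" "\<And>h. h \<ge> 0 \<Longrightarrow> (exp (K * h))-lipschitz_on UNIV (\<phi>\<^sub>0 h)"
    using quasicontraction_semigroup_lipschitz_on[OF assms(1)] by blast
  obtain B where B: "eventually (\<lambda>h. (B * h)-lipschitz_on UNIV (\<lambda>u. \<Phi> h u - \<phi>\<^sub>0 h u)) (at_right 0)"
    using assms(2) unfolding lipschitz_close_def by blast
  obtain C where C: "eventually (\<lambda>h. (C * h)-lipschitz_on UNIV
      (\<lambda>u. (\<Phi> h ^^ m) u - \<phi>\<^sub>0 (real m * h) u)) (at_right 0)"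
    using Suc unfolding lipschitz_close_def by blast
  \<comment> \<open>The two summands match the two terms of the decomposition. For
    \<open>0 < h < 1\<close> the iterate \<open>\<Phi> h ^^ m\<close> has Lipschitz constant
    \<open>C + exp (K * real m)\<close>, by the induction hypothesis and the bound on
    \<open>\<phi>\<^sub>0\<close>, while \<open>\<phi>\<^sub>0 h\<close> has Lipschitz constant
    \<open>exp K\<close>.\<close>
  define D where "D = B * (C + exp (K * real m)) + exp K * C"
  have "eventually (\<lambda>h. (D * h)-lipschitz_on UNIV
      (\<lambda>u. (\<Phi> h ^^ Suc m) u - \<phi>\<^sub>0 (real (Suc m) * h) u)) (at_right 0)"
    using B C eventually_at_right_real[of 0 1, OF zero_less_one]
  proof eventually_elim
    case (elim h)
    then have h: "0 < h" "h < 1" and nonneg: "0 \<le> B * h" "0 \<le> C * h"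
      using lipschitz_on_nonneg by auto
    have "0 \<le> C"
      using h nonneg by (simp add: zero_le_mult_iff)
    have lip\<^sub>0: "(exp K)-lipschitz_on UNIV (\<phi>\<^sub>0 h)"
      using K(2)[of h] by (rule lipschitz_on_mono) (use h K(1) in \<open>auto intro: mult_left_le\<close>)
    have "(C * h + exp (K * (real m * h)))-lipschitz_on UNIV
        (\<lambda>u. ((\<Phi> h ^^ m) u - \<phi>\<^sub>0 (real m * h) u) + \<phi>\<^sub>0 (real m * h) u)"
      using elim h K(2)[of "real m * h"] by (intro lipschitz_on_add) auto
    then have "(C * h + exp (K * (real m * h)))-lipschitz_on UNIV (\<Phi> h ^^ m)"
      by simp
    then have lip_m: "(C + exp (K * real m))-lipschitz_on UNIV (\<Phi> h ^^ m)"
      by (rule lipschitz_on_mono)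
         (use h K \<open>0 \<le> C\<close> in \<open>auto intro!: add_mono mult_left_le mult_left_mono\<close>)
    have "(B * h * (C + exp (K * real m)) + exp K * (C * h))-lipschitz_on UNIV
        (\<lambda>u. (\<Phi> h ((\<Phi> h ^^ m) u) - \<phi>\<^sub>0 h ((\<Phi> h ^^ m) u)) +
             \<phi>\<^sub>0 h ((\<Phi> h ^^ m) u - \<phi>\<^sub>0 (real m * h) u))"
    proof (rule lipschitz_on_add)
      show "(B * h * (C + exp (K * real m)))-lipschitz_on UNIV
          (\<lambda>u. \<Phi> h ((\<Phi> h ^^ m) u) - \<phi>\<^sub>0 h ((\<Phi> h ^^ m) u))"
        by (rule lipschitz_on_compose2[OF lip_m]) (use elim in \<open>auto intro: lipschitz_on_subset\<close>)
      show "(exp K * (C * h))-lipschitz_on UNIV (\<lambda>u. \<phi>\<^sub>0 h ((\<Phi> h ^^ m) u - \<phi>\<^sub>0 (real m * h) u))"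
        by (rule lipschitz_on_compose2) (use elim lip\<^sub>0 in \<open>auto intro: lipschitz_on_subset\<close>)
    qed
    moreover have "(\<Phi> h ((\<Phi> h ^^ m) u) - \<phi>\<^sub>0 h ((\<Phi> h ^^ m) u)) +
        \<phi>\<^sub>0 h ((\<Phi> h ^^ m) u - \<phi>\<^sub>0 (real m * h) u) = (\<Phi> h ^^ Suc m) u - \<phi>\<^sub>0 (real (Suc m) * h) u" for u
      using quasicontraction_semigroup_add[OF assms(1), of h "real m * h"] h
        bounded_linear.linear[OF quasicontraction_semigroup_bounded_linear[OF assms(1), of h]]
      by (simp add: linear_diff distrib_right)
    moreover have "B * h * (C + exp (K * real m)) + exp K * (C * h) = D * h"
      by (simp add: D_def algebra_simps)
    ultimately show ?case
      by simp
  qed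
  then show ?case
    unfolding lipschitz_close_def by blast
qed

text \<open>Since \<open>m\<close> steps of length \<open>h / m\<close> cover time \<open>h\<close>,
  every iterate is compared with the same map \<open>\<phi>\<^sub>0 h\<close>, as an affine
  combination over different \<open>m\<close> requires.\<close>

lemma lipschitz_close_funpow_rescale:
  assumes "quasicontraction_semigroup \<phi>\<^sub>0" "lipschitz_close \<Phi> \<phi>\<^sub>0" "m > 0"
  shows "lipschitz_close (\<lambda>h. \<Phi> (h / real m) ^^ m) \<phi>\<^sub>0"
  using lipschitz_close_rescale[OF lipschitz_close_funpow[OF assms(1,2), of m], of "real m"] assms(3)
  by simp

subsection \<open>Stability of the methods\<close>

text \<open>The base map and the number of steps both depend on an abstract index, so that one
  statement covers the methods with one fixed sign and the symmetric one.\<close>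

lemma stable_map_affine_combination_funpow:
  assumes "quasicontraction_semigroup \<phi>\<^sub>0"
    and "\<And>i. i \<in> I \<Longrightarrow> lipschitz_map (\<Phi> i)" "\<And>i. i \<in> I \<Longrightarrow> lipschitz_close (\<Phi> i) \<phi>\<^sub>0"
    and "\<And>i. i \<in> I \<Longrightarrow> m i > 0" "(\<Sum>i\<in>I. c i) = 1"
  shows "stable_map (\<lambda>h u. \<Sum>i\<in>I. c i *\<^sub>R (\<Phi> i (h / real (m i)) ^^ m i) u)"
proof (rule lipschitz_close_stable_map)
  show "lipschitz_map (\<lambda>h u. \<Sum>i\<in>I. c i *\<^sub>R (\<Phi> i (h / real (m i)) ^^ m i) u)"
    using assms(2,5)
    by (intro lipschitz_map_affine_combination lipschitz_map_rescale[OF lipschitz_map_funpow]) auto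
  show "lipschitz_close (\<lambda>h u. \<Sum>i\<in>I. c i *\<^sub>R (\<Phi> i (h / real (m i)) ^^ m i) u) \<phi>\<^sub>0"
    using assms by (intro lipschitz_close_affine_combination lipschitz_close_funpow_rescale) auto
qed (fact assms(1))

lemma stable_map_asymmetric_method:
  assumes "quasicontraction_semigroup \<phi>\<^sub>0" "lipschitz_map \<Phi>" "lipschitz_close \<Phi> \<phi>\<^sub>0"
    and "(\<Sum>m=1..s. \<gamma> m) = 1"
  shows "stable_map (asymmetric_method s \<gamma> \<Phi>)"
proof -
  have "asymmetric_method s \<gamma> \<Phi> = (\<lambda>h u. \<Sum>m\<in>{1..s}. \<gamma> m *\<^sub>R (\<Phi> (h / real m) ^^ m) u)"
    by (intro ext) (simp add: asymmetric_method_def)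
  then show ?thesis
    using stable_map_affine_combination_funpow[OF assms(1), of "{1..s}" "\<lambda>_. \<Phi>" "\<lambda>m. m" \<gamma>] assms
    by simp
qed

lemma stable_map_symmetric_method:
  assumes "quasicontraction_semigroup \<phi>\<^sub>0"
    and "lipschitz_map \<Phi>" "lipschitz_close \<Phi> \<phi>\<^sub>0" "lipschitz_map \<Psi>" "lipschitz_close \<Psi> \<phi>\<^sub>0"
    and "(\<Sum>m=1..s. \<gamma> m) = 1 / 2"
  shows "stable_map (symmetric_method s \<gamma> \<Phi> \<Psi>)"
proof -
  \<comment> \<open>Indexing by pairs of a step count and a boolean that selects the base map makes
    each \<open>\<gamma> m\<close> occur twice; the total weight is therefore twice
    \<open>1 / 2\<close>.\<close>
  let ?X = "\<lambda>b. if b then \<Phi> else \<Psi>"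
  have "(\<Sum>i\<in>{1..s} \<times> (UNIV :: bool set). \<gamma> (fst i)) = (\<Sum>m=1..s. \<Sum>b\<in>(UNIV :: bool set). \<gamma> m)"
    by (simp add: sum.cartesian_product case_prod_unfold del: sum_constant)
  also have "\<dots> = 1"
    using assms(6) by (simp add: UNIV_bool flip: sum_distrib_left)
  finally have "stable_map (\<lambda>h u. \<Sum>i\<in>{1..s} \<times> UNIV.
      \<gamma> (fst i) *\<^sub>R (?X (snd i) (h / real (fst i)) ^^ fst i) u)"
    using assms by (intro stable_map_affine_combination_funpow[where \<phi>\<^sub>0 = \<phi>\<^sub>0]) auto
  also have "(\<lambda>h u. \<Sum>i\<in>{1..s} \<times> UNIV. \<gamma> (fst i) *\<^sub>R (?X (snd i) (h / real (fst i)) ^^ fst i) u) =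
      (\<lambda>h u. \<Sum>m=1..s. \<Sum>b\<in>UNIV. \<gamma> m *\<^sub>R (?X b (h / real m) ^^ m) u)"
    by (simp only: sum.cartesian_product case_prod_unfold)
  also have "\<dots> = symmetric_method s \<gamma> \<Phi> \<Psi>"
    by (intro ext) (simp add: symmetric_method_def UNIV_bool scaleR_add_right add.commute)
  finally show ?thesis .
qed

theorem proposition3p8:
  fixes \<phi>\<^sub>0 \<phi>\<^sub>1 :: "real \<Rightarrow> 'a::{real_inner, complete_space} \<Rightarrow> 'a"
    and s :: nat and \<gamma> :: "nat \<Rightarrow> real"
  assumes "quasicontraction_semigroup \<phi>\<^sub>0"
    and "uniformly_stable_map \<phi>\<^sub>1"
  shows "((\<Sum>m=1..s. \<gamma> m) = 1 \<longrightarrow>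
            stable_map (asymmetric_method s \<gamma> (Phi_plus \<phi>\<^sub>0 \<phi>\<^sub>1)) \<and>
            stable_map (asymmetric_method s \<gamma> (Phi_minus \<phi>\<^sub>0 \<phi>\<^sub>1))) \<and>
         ((\<Sum>m=1..s. \<gamma> m) = 1 / 2 \<longrightarrow>
            stable_map (symmetric_method s \<gamma> (Phi_plus \<phi>\<^sub>0 \<phi>\<^sub>1) (Phi_minus \<phi>\<^sub>0 \<phi>\<^sub>1)))"
proof -
  have "lipschitz_map \<phi>\<^sub>0" "lipschitz_map \<phi>\<^sub>1"
    using assms quasicontraction_semigroup_lipschitz_map unfolding uniformly_stable_map_def by auto
  then have "lipschitz_map (Phi_plus \<phi>\<^sub>0 \<phi>\<^sub>1)" "lipschitz_map (Phi_minus \<phi>\<^sub>0 \<phi>\<^sub>1)"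
    using lipschitz_map_comp by (auto simp: Phi_plus_def[abs_def] Phi_minus_def[abs_def])
  moreover have "lipschitz_close (Phi_plus \<phi>\<^sub>0 \<phi>\<^sub>1) \<phi>\<^sub>0" "lipschitz_close (Phi_minus \<phi>\<^sub>0 \<phi>\<^sub>1) \<phi>\<^sub>0"
    using assms uniformly_stable_map_lipschitz_close
    by (blast intro: lipschitz_close_Phi_plus lipschitz_close_Phi_minus)+
  ultimately show ?thesis
    using assms(1) by (blast intro: stable_map_asymmetric_method stable_map_symmetric_method)
qed

end
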